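(* Let $\mathcal{H}$ be a real Hilbert space and let $T:\mathcal{H}\to\mathcal{H}$ be a nonexpansive mapping with $Fix(T)\neq\emptyset$. Let $x^0\in\mathcal{H}$ be arbitrary and let $\{x^k\}_{k=0}^\infty$ be the sequence generated by $$x^k=\frac{1}{\varphi_k+1}x^0+\frac{\varphi_k}{\varphi_k+1}Tx^{k-1},\qquad \varphi_k:=\frac{2\langle x^{k-1}-Tx^{k-1},\,x^0-x^{k-1}\rangle}{\|x^{k-1}-Tx^{k-1}\|^2}+1,\qquad k\ge 1,$$ where it is assumed that $x^k\neq Tx^k$ for all $k\ge 0$ (so that the process does not terminate). Then $\{x^k\}_{k=0}^\infty$ converges strongly (i.e. in norm) to a fixed point of $T$.
   Context: A mapping $T:\mathcal{H}\to\mathcal{H}$ is nonexpansive if $\|Tx-Ty\|\le\|x-y\|$ for all $x,y\in\mathcal{H}$. $Fix(T)=\{x\in\mathcal{H}: x=Tx\}$. The sequence is the Halpern iteration with adaptive anchoring parameters: for $k=1,2,\dots$, given $x^{k-1}$, the process terminates if $x^{k-1}=Tx^{k-1}$; otherwise $\varphi_k$ and then $x^k$ are computed by the displayed formulas. Standing assumption: $x^k\ne Tx^k$ for all $k\ge 0$, i.e. an infinite sequence is generated. *)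

theory Defs
  imports "HOL-Analysis.Analysis"
begin

definition nonexpansive :: "('a::real_normed_vector \<Rightarrow> 'a) \<Rightarrow> bool" where
  "nonexpansive T \<longleftrightarrow> (\<forall>x y. norm (T x - T y) \<le> norm (x - y))"

definition Fix :: "('a \<Rightarrow> 'a) \<Rightarrow> 'a set" where
  "Fix T = {x. x = T x}"

end

theory Submission
  imports Defs
begin

text \<open>Write \<open>a = x 0\<close>, \<open>A = I - T\<close> and \<open>\<lambda>\<^sub>k = 1 / (\<phi>\<^sub>k + 1)\<close>. The adaptive choice of \<open>\<phi>\<close> yields
  \<open>\<phi>\<^sub>k \<parallel>A x\<^sub>k\<parallel>\<^sup>2 \<le> 2 \<langle>A x\<^sub>k, a - x\<^sub>k\<rangle>\<close>, hence \<open>\<phi>\<^sub>k \<ge> k\<close> and \<open>\<parallel>A x\<^sub>k\<parallel> = O(\<lambda>\<^sub>k)\<close>. If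
  \<open>\<Sum> \<lambda>\<^sub>k < \<infinity>\<close>, the increments of \<open>x\<close> are summable. Otherwise Xu's lemma on the recursion
  \<open>s\<^sub>k \<le> (1 - \<lambda>\<^sub>k) s\<^sub>k\<^sub>-\<^sub>1 + \<lambda>\<^sub>k b\<^sub>k\<close> applies to \<open>s\<^sub>k = \<parallel>x\<^sub>k - p\<parallel>\<^sup>2\<close>, where \<open>p\<close> is the limit of the
  resolvent path \<open>A z = (a - z) / \<mu>\<close>, \<open>\<mu> \<rightarrow> \<infinity>\<close>; comparing \<open>x\<^sub>k\<close> with this path by monotonicity of \<open>A\<close>
  gives \<open>limsup \<langle>a - p, x\<^sub>k - p\<rangle> \<le> 0\<close> without weak compactness.\<close>

section \<open>Nonexpansive maps, their residuals, and one adaptive step\<close>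

lemma nonexpansiveD: "nonexpansive T \<Longrightarrow> norm (T x - T y) \<le> norm (x - y)"
  by (simp add: nonexpansive_def)

lemma nonexpansive_isCont:
  assumes "nonexpansive T"
  shows "isCont T x"
proof -
  have "1-lipschitz_on UNIV T"
    using assms by (auto intro!: lipschitz_onI simp: nonexpansive_def dist_norm)
  then show ?thesis
    using lipschitz_on_continuous_on continuous_on_eq_continuous_at open_UNIV by blast
qed

text \<open>Cauchy-Schwarz suffices; this monotonicity of \<open>I - T\<close> drives every
  comparison of points with the resolvent path.\<close>

lemma nonexpansive_residual_monotone:
  fixes T :: "'a::real_inner \<Rightarrow> 'a"
  assumes "nonexpansive T"
  shows "0 \<le> inner ((x - T x) - (y - T y)) (x - y)"
proof -
  have "inner (T x - T y) (x - y) \<le> norm (T x - T y) * norm (x - y)"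
    by (rule norm_cauchy_schwarz)
  also have "\<dots> \<le> norm (x - y) * norm (x - y)"
    using nonexpansiveD[OF assms] by (intro mult_right_mono) auto
  also have "\<dots> = inner (x - y) (x - y)"
    by (simp add: dot_square_norm power2_eq_square)
  finally show ?thesis
    by (simp add: inner_diff_left)
qed

text \<open>This \<open>\<phi>\<close> makes \<open>v\<close> equidistant from \<open>u\<close> and
  \<open>T u\<close>: the formula amounts to \<open>2 * inner r d = - inner r r\<close>, that is |d
  + r| = |d|, where d + r = v - T u. So |T v - T u| <= |v - u| = |v - T u|; expanding with T v - T u
  = (d + r) - s and using a - v = \<open>\<phi>\<close> (d + r) gives the claim.\<close>

lemma adaptive_halpern_step:
  fixes T :: "'a::real_inner \<Rightarrow> 'a"
  assumes "nonexpansive T" and "u \<noteq> T u" and "\<phi> > 0"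
    and phi: "\<phi> = 2 * inner (u - T u) (a - u) / (norm (u - T u))\<^sup>2 + 1"
    and v: "v = (1 / (\<phi> + 1)) *\<^sub>R a + (\<phi> / (\<phi> + 1)) *\<^sub>R T u"
  shows "\<phi> * (norm (v - T v))\<^sup>2 \<le> 2 * inner (v - T v) (a - v)"
proof -
  define r s d where "r = u - T u" and "s = v - T v" and "d = v - u"
  have "(\<phi> + 1) *\<^sub>R v = a + \<phi> *\<^sub>R T u"
    using \<open>\<phi> > 0\<close> by (simp add: v scaleR_add_right)
  then have av: "a - v = \<phi> *\<^sub>R (d + r)"
    by (simp add: r_def d_def algebra_simps)
  then have au: "a - u = (\<phi> + 1) *\<^sub>R d + \<phi> *\<^sub>R r"
    by (simp add: d_def algebra_simps)
  have "2 * inner r (a - u) = (\<phi> - 1) * inner r r"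
    using phi \<open>u \<noteq> T u\<close> by (simp add: r_def power2_norm_eq_inner)
  then have "(\<phi> + 1) * (2 * inner r d + inner r r) = 0"
    by (simp add: au algebra_simps)
  then have rd: "2 * inner r d = - inner r r"
    using \<open>\<phi> > 0\<close> by simp
  have "(norm (T v - T u))\<^sup>2 \<le> (norm (v - u))\<^sup>2"
    using nonexpansiveD[OF assms(1)] by (simp add: power_mono)
  moreover have "T v - T u = d + r - s"
    by (simp add: r_def s_def d_def)
  ultimately have "inner (d + r - s) (d + r - s) \<le> inner d d"
    by (simp add: power2_norm_eq_inner d_def)
  then have "inner s s \<le> 2 * inner s (d + r)"
    using rd by (simp add: algebra_simps inner_commute)
  then have "\<phi> * inner s s \<le> \<phi> * (2 * inner s (d + r))"
    using \<open>\<phi> > 0\<close> by (intro mult_left_mono) auto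
  then show ?thesis
    using av by (simp add: s_def power2_norm_eq_inner algebra_simps)
qed

section \<open>The resolvent path and its limit\<close>

lemma resolvent_exists:
  fixes T :: "'h::{real_inner, complete_space} \<Rightarrow> 'h"
  assumes "nonexpansive T" and "\<mu> > 0"
  shows "\<exists>z. a - z = \<mu> *\<^sub>R (z - T z)"
proof -
  \<comment> \<open>Solving the resolvent equation for \<open>z\<close> gives
    \<open>z = f z\<close>, and \<open>f\<close> contracts with factor
    \<open>\<mu> / (\<mu> + 1)\<close>.\<close>
  define f where "f z = (1 / (\<mu> + 1)) *\<^sub>R a + (\<mu> / (\<mu> + 1)) *\<^sub>R T z" for z
  have "\<exists>!z. f z = z"
  proof (rule banach_fix_type)
    show "\<mu> / (\<mu> + 1) < 1" "0 \<le> \<mu> / (\<mu> + 1)"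
      using \<open>\<mu> > 0\<close> by auto
    show "\<forall>y z. dist (f y) (f z) \<le> \<mu> / (\<mu> + 1) * dist y z"
    proof (intro allI)
      fix y z
      have "f y - f z = (\<mu> / (\<mu> + 1)) *\<^sub>R (T y - T z)"
        by (simp add: f_def algebra_simps)
      then have "dist (f y) (f z) = \<mu> / (\<mu> + 1) * norm (T y - T z)"
        using \<open>\<mu> > 0\<close> by (simp add: dist_norm)
      also have "\<dots> \<le> \<mu> / (\<mu> + 1) * norm (y - z)"
        using \<open>\<mu> > 0\<close> by (intro mult_left_mono nonexpansiveD assms) auto
      finally show "dist (f y) (f z) \<le> \<mu> / (\<mu> + 1) * dist y z"
        by (simp add: dist_norm)
    qed
  qed
  then obtain z where "f z = z" by auto
  then have "(\<mu> + 1) *\<^sub>R z = (\<mu> + 1) *\<^sub>R f z" by simp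
  also have "\<dots> = a + \<mu> *\<^sub>R T z"
    using \<open>\<mu> > 0\<close> by (simp add: f_def scaleR_add_right)
  finally show ?thesis
    by (intro exI[of _ z]) (simp add: algebra_simps)
qed

text \<open>Monotonicity is tested against \<open>q\<close>, whose residual vanishes. The bound does
  not depend on \<open>\<mu>\<close>, so the whole path is bounded.\<close>

lemma resolvent_dist_le:
  fixes T :: "'a::real_inner \<Rightarrow> 'a"
  assumes "nonexpansive T" and "q \<in> Fix T" and "\<mu> > 0" and z: "a - z = \<mu> *\<^sub>R (z - T z)"
  shows "norm (z - a) \<le> norm (a - q)"
proof -
  have "0 \<le> \<mu> * inner ((z - T z) - (q - T q)) (z - q)"
    using nonexpansive_residual_monotone[OF assms(1)] \<open>\<mu> > 0\<close> by simp
  also have "\<dots> = inner (a - z) (z - q)"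
    using \<open>q \<in> Fix T\<close> by (simp add: z Fix_def)
  also have "\<dots> = inner (a - z) (a - q) - inner (a - z) (a - z)"
    by (simp flip: inner_diff_right)
  finally have "norm (a - z) * norm (a - z) \<le> inner (a - z) (a - q)"
    by (simp add: dot_square_norm power2_eq_square)
  also have "\<dots> \<le> norm (a - z) * norm (a - q)"
    by (rule norm_cauchy_schwarz)
  finally show ?thesis
    by (cases "a = z") (auto simp: norm_minus_commute)
qed

text \<open>Squared distances to \<open>a\<close> grow with the parameter, and their growth controls
  the gaps along the path; a Cauchy property of these real numbers thus passes to the path.\<close>

lemma resolvent_dist_increment:
  fixes T :: "'a::real_inner \<Rightarrow> 'a"
  assumes "nonexpansive T" and "0 < \<mu>" and "\<mu> < \<nu>"
    and y: "a - y = \<mu> *\<^sub>R (y - T y)" and z: "a - z = \<nu> *\<^sub>R (z - T z)"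
  shows "(norm (y - z))\<^sup>2 \<le> (norm (z - a))\<^sup>2 - (norm (y - a))\<^sup>2"
proof -
  define v w where "v = y - a" and "w = z - a"
  have "0 \<le> \<mu> * \<nu> * inner ((y - T y) - (z - T z)) (y - z)"
    using nonexpansive_residual_monotone[OF assms(1)] assms(2,3) by simp
  also have "\<dots> = inner (\<nu> *\<^sub>R (\<mu> *\<^sub>R (y - T y)) - \<mu> *\<^sub>R (\<nu> *\<^sub>R (z - T z))) (y - z)"
    by (simp add: inner_diff_left algebra_simps)
  also have "\<dots> = inner (\<mu> *\<^sub>R w - \<nu> *\<^sub>R v) (v - w)"
    by (simp add: v_def w_def flip: y z) (simp add: algebra_simps)
  finally have *: "\<nu> * inner v v + \<mu> * inner w w \<le> (\<mu> + \<nu>) * inner v w"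
    by (simp add: algebra_simps inner_commute)
  have "(\<mu> + \<nu>) * inner (v - w) (v - w)
      = (\<mu> + \<nu>) * (inner v v + inner w w) - 2 * ((\<mu> + \<nu>) * inner v w)"
    by (simp add: algebra_simps inner_commute)
  also have "\<dots> \<le> (\<nu> - \<mu>) * (inner w w - inner v v)"
    using * by (simp add: algebra_simps)
  finally have le: "(\<mu> + \<nu>) * inner (v - w) (v - w) \<le> (\<nu> - \<mu>) * (inner w w - inner v v)" .
  \<comment> \<open>Nonnegativity of the left side of \<open>le\<close> fixes the sign of |w|^2 -
    |v|^2; only then may \<open>\<nu> - \<mu>\<close> be enlarged to \<open>\<mu> + \<nu>\<close>,
    which cancels.\<close>
  moreover have "0 \<le> (\<mu> + \<nu>) * inner (v - w) (v - w)"
    using assms(2,3) by simp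
  ultimately have "0 \<le> (\<nu> - \<mu>) * (inner w w - inner v v)" by linarith
  then have "0 \<le> inner w w - inner v v"
    using assms(3) by (simp add: zero_le_mult_iff)
  then have "(\<nu> - \<mu>) * (inner w w - inner v v) \<le> (\<mu> + \<nu>) * (inner w w - inner v v)"
    using assms(2) by (intro mult_right_mono) auto
  with le have "(\<mu> + \<nu>) * inner (v - w) (v - w) \<le> (\<mu> + \<nu>) * (inner w w - inner v v)"
    by linarith
  then have "inner (v - w) (v - w) \<le> inner w w - inner v v"
    using assms(2,3) by (simp only: mult_le_cancel_left_pos)
  then show ?thesis
    by (simp add: v_def w_def power2_norm_eq_inner)
qed

text \<open>The squared distances to \<open>a\<close> are increasing and bounded, hence Cauchy, and
  so is \<open>z\<close>. Its limit is fixed because the residual is a bounded vector divided by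
  \<open>Suc n\<close>.\<close>

lemma resolvent_path_convergent:
  fixes T :: "'h::{real_inner, complete_space} \<Rightarrow> 'h"
  assumes "nonexpansive T" and "q \<in> Fix T"
    and z: "\<And>n. a - z n = real (Suc n) *\<^sub>R (z n - T (z n))"
  shows "\<exists>p \<in> Fix T. z \<longlonglongrightarrow> p"
proof -
  define g where "g n = (norm (z n - a))\<^sup>2" for n
  have bound: "norm (z n - a) \<le> norm (a - q)" for n
    using resolvent_dist_le[OF assms(1,2) _ z[of n]] by simp
  have inc: "(norm (z m - z n))\<^sup>2 \<le> g n - g m" if "m < n" for m n
    unfolding g_def using that by (intro resolvent_dist_increment[OF assms(1) _ _ z z]) auto
  have "mono g"
  proof (rule incseq_SucI)
    show "g n \<le> g (Suc n)" for n
      using order_trans[OF zero_le_power2 inc[of n "Suc n"]] by simp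
  qed
  moreover have "g n \<le> (norm (a - q))\<^sup>2" for n
    using bound by (simp add: g_def power_mono)
  ultimately obtain l where "g \<longlonglongrightarrow> l"
    using incseq_convergent by metis
  then have "Cauchy g" by (rule LIMSEQ_imp_Cauchy)
  have "Cauchy z"
  proof (rule CauchyI')
    fix e :: real assume "e > 0"
    then obtain M where M: "\<And>m n. m \<ge> M \<Longrightarrow> n \<ge> M \<Longrightarrow> norm (g m - g n) < e\<^sup>2"
      using CauchyD[OF \<open>Cauchy g\<close>, of "e\<^sup>2"] by (metis zero_less_power)
    show "\<exists>M. \<forall>m\<ge>M. \<forall>n>m. dist (z m) (z n) < e"
    proof (intro exI allI impI)
      fix m n assume "M \<le> m" "m < n"
      then have "(norm (z m - z n))\<^sup>2 < e\<^sup>2"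
        using inc[of m n] M[of n m] by (simp add: abs_if split: if_splits)
      then show "dist (z m) (z n) < e"
        unfolding dist_norm using \<open>e > 0\<close> by (meson less_eq_real_def power_less_imp_less_base)
    qed
  qed
  then obtain p where p: "z \<longlonglongrightarrow> p"
    using Cauchy_convergent convergent_def by blast
  have "(\<lambda>n. z n - T (z n)) \<longlonglongrightarrow> p - T p"
    by (intro tendsto_diff p isCont_tendsto_compose[OF nonexpansive_isCont[OF assms(1)]])
  moreover have "(\<lambda>n. z n - T (z n)) \<longlonglongrightarrow> 0"
  proof -
    have "(\<lambda>n. inverse (real (Suc n)) *\<^sub>R (a - z n)) \<longlonglongrightarrow> 0 *\<^sub>R (a - p)"
      by (intro tendsto_intros p LIMSEQ_inverse_real_of_nat)
    moreover have "inverse (real (Suc n)) *\<^sub>R (a - z n) = z n - T (z n)" for n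
      unfolding z by (simp del: of_nat_Suc)
    ultimately show ?thesis by simp
  qed
  ultimately have "p - T p = 0"
    using LIMSEQ_unique by blast
  with p show ?thesis
    by (auto simp: Fix_def)
qed

text \<open>The order of choices matters: first a path point \<open>w\<close> near \<open>p\<close>
  is frozen, and with it \<open>\<mu>\<close>. Monotonicity then bounds
  \<open>inner (a - w) (y k - w)\<close> by \<open>\<mu>\<close> times the residual of
  \<open>y k\<close> times a bounded distance, which vanishes as \<open>k\<close> grows.\<close>

lemma limsup_inner_resolvent_limit:
  fixes T :: "'a::real_inner \<Rightarrow> 'a"
  assumes "nonexpansive T"
    and z: "\<And>n. a - z n = real (Suc n) *\<^sub>R (z n - T (z n))" and p: "z \<longlonglongrightarrow> p"
    and y: "(\<lambda>k. y k - T (y k)) \<longlonglongrightarrow> 0" and bound: "\<And>k. norm (y k - p) \<le> D"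
    and "e > 0"
  shows "\<forall>\<^sub>F k in sequentially. inner (a - p) (y k - p) \<le> e"
proof -
  \<comment> \<open>With \<open>w = z n\<close>, this product bounds the total cost of replacing
    \<open>w\<close> by \<open>p\<close> in both arguments of
    \<open>inner (a - w) (y k - w)\<close>.\<close>
  have "(\<lambda>n. norm (z n - p) * (D + norm (z n - p) + norm (a - p))) \<longlonglongrightarrow>
      norm (p - p) * (D + norm (p - p) + norm (a - p))"
    by (intro tendsto_intros p)
  then have "\<forall>\<^sub>F n in sequentially. norm (z n - p) * (D + norm (z n - p) + norm (a - p)) < e / 2"
    using \<open>e > 0\<close> by (intro order_tendstoD) auto
  then obtain n where n: "norm (z n - p) * (D + norm (z n - p) + norm (a - p)) < e / 2"
    by (auto simp: eventually_sequentially)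
  define \<mu> w where "\<mu> = real (Suc n)" and "w = z n"
  have w: "a - w = \<mu> *\<^sub>R (w - T w)" and "\<mu> > 0"
    using z by (auto simp: \<mu>_def w_def)
  have dist: "norm (y k - w) \<le> D + norm (w - p)" for k
    using bound[of k] norm_triangle_ineq4[of "y k - p" "w - p"] by simp
  have "(\<lambda>k. \<mu> * (norm (y k - T (y k)) * (D + norm (w - p)))) \<longlonglongrightarrow> \<mu> * (norm (0::'a) * (D + norm (w - p)))"
    by (intro tendsto_intros y)
  then have "\<forall>\<^sub>F k in sequentially. \<mu> * (norm (y k - T (y k)) * (D + norm (w - p))) < e / 2"
    using \<open>e > 0\<close> by (intro order_tendstoD) auto
  then show ?thesis
  proof eventually_elim
    case (elim k)
    have "0 \<le> \<mu> * inner ((w - T w) - (y k - T (y k))) (w - y k)"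
      using nonexpansive_residual_monotone[OF assms(1)] \<open>\<mu> > 0\<close> by simp
    also have "\<dots> = inner (\<mu> *\<^sub>R (w - T w)) (w - y k) - \<mu> * inner (y k - T (y k)) (w - y k)"
      by (simp add: algebra_simps)
    also have "\<dots> = \<mu> * inner (y k - T (y k)) (y k - w) - inner (a - w) (y k - w)"
      unfolding w[symmetric] by (simp add: algebra_simps)
    finally have "inner (a - w) (y k - w) \<le> \<mu> * inner (y k - T (y k)) (y k - w)" by simp
    also have "\<dots> \<le> \<mu> * (norm (y k - T (y k)) * norm (y k - w))"
      using \<open>\<mu> > 0\<close> by (intro mult_left_mono norm_cauchy_schwarz) auto
    also have "\<dots> \<le> \<mu> * (norm (y k - T (y k)) * (D + norm (w - p)))"
      using \<open>\<mu> > 0\<close> by (intro mult_left_mono dist) auto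
    finally have 1: "inner (a - w) (y k - w) \<le> e / 2"
      using elim by simp
    have "inner (w - p) (y k - w) \<le> norm (w - p) * norm (y k - w)"
      by (rule norm_cauchy_schwarz)
    also have "\<dots> \<le> norm (w - p) * (D + norm (w - p))"
      by (intro mult_left_mono dist) auto
    finally have "inner (w - p) (y k - w) \<le> norm (w - p) * (D + norm (w - p))" .
    moreover have "inner (a - p) (w - p) \<le> norm (w - p) * norm (a - p)"
      using norm_cauchy_schwarz[of "a - p" "w - p"] by (simp add: mult.commute)
    ultimately have "inner (w - p) (y k - w) + inner (a - p) (w - p) \<le> e / 2"
      using n by (simp add: w_def distrib_left)
    moreover have "inner (a - p) (y k - p)
        = inner (a - w) (y k - w) + (inner (w - p) (y k - w) + inner (a - p) (w - p))"
      by (simp add: inner_diff_left inner_diff_right)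
    ultimately show ?case
      using 1 by linarith
  qed
qed

section \<open>Scalar recursions and summable increments\<close>

lemma Xu_recursion_tendsto_0:
  fixes s b l :: "nat \<Rightarrow> real"
  assumes s: "\<And>k. 0 \<le> s k" and l: "\<And>k. 0 \<le> l k" "\<And>k. l k \<le> 1" and "\<not> summable l"
    and rec: "\<And>k. s (Suc k) \<le> (1 - l k) * s k + l k * b k"
    and b: "\<And>e. e > 0 \<Longrightarrow> \<forall>\<^sub>F k in sequentially. b k \<le> e"
  shows "s \<longlonglongrightarrow> 0"
proof (rule order_tendstoI)
  fix e :: real assume "0 < e"
  obtain N where N: "\<And>k. k \<ge> N \<Longrightarrow> b k \<le> e / 2"
    using b[of "e / 2"] \<open>0 < e\<close> by (auto simp: eventually_sequentially)
  \<comment> \<open>Once \<open>b k\<close> is at most \<open>e / 2\<close>, the excess of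
    \<open>s\<close> over \<open>e / 2\<close> shrinks by the factor \<open>1 - l k\<close>;
    divergence of the sum of \<open>l\<close> makes the product of these factors vanish.\<close>
  have step: "s (Suc k) - e / 2 \<le> (1 - l k) * (s k - e / 2)" if "k \<ge> N" for k
    using rec[of k] mult_left_mono[OF N[OF that] l(1)[of k]] by (simp add: field_simps)
  \<comment> \<open>Keeping \<open>s N\<close> rather than \<open>s N - e / 2\<close> leaves a
    nonnegative factor, so \<open>1 - l\<close> may be replaced by \<open>exp (- l)\<close>.\<close>
  have decay: "s (N + j) - e / 2 \<le> exp (- (\<Sum>i<j. l (N + i))) * s N" for j
  proof (induction j)
    case 0
    then show ?case using \<open>0 < e\<close> by simp
  next
    case (Suc j)
    have "s (N + Suc j) - e / 2 \<le> (1 - l (N + j)) * (s (N + j) - e / 2)"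
      using step[of "N + j"] by simp
    also have "\<dots> \<le> (1 - l (N + j)) * (exp (- (\<Sum>i<j. l (N + i))) * s N)"
      using l by (intro mult_left_mono Suc) auto
    also have "\<dots> \<le> exp (- l (N + j)) * (exp (- (\<Sum>i<j. l (N + i))) * s N)"
      using exp_ge_add_one_self[of "- l (N + j)"] s by (intro mult_right_mono) auto
    finally show ?case
      by (simp add: exp_diff exp_minus field_simps exp_add)
  qed
  have "\<not> summable (\<lambda>i. l (N + i))"
    using \<open>\<not> summable l\<close> by (simp add: add.commute[of N] summable_iff_shift)
  \<comment> \<open>The threshold is chosen so that \<open>exp S \<ge> 1 + S\<close> already forces
    \<open>exp (- S) * s N < e / 2\<close>.\<close>
  then obtain J where J: "(\<Sum>i<J. l (N + i)) > s N * 2 / e"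
    using l(1) summableI_nonneg_bounded[of "\<lambda>i. l (N + i)" "s N * 2 / e"] by (meson not_le)
  have "s (N + j) < e" if "j \<ge> J" for j
  proof -
    define S where "S = (\<Sum>i<j. l (N + i))"
    have "(\<Sum>i<J. l (N + i)) \<le> S"
      unfolding S_def using that l by (intro sum_mono2) auto
    with J have "s N * 2 / e < 1 + S" by simp
    also have "\<dots> \<le> exp S" by (rule exp_ge_add_one_self)
    finally have "exp (- S) * s N < e / 2"
      using \<open>0 < e\<close> by (simp add: exp_minus field_simps)
    then show ?thesis
      using decay[of j] by (simp add: S_def)
  qed
  then show "\<forall>\<^sub>F k in sequentially. s k < e"
    unfolding eventually_sequentially
    by (intro exI[of _ "N + J"] allI impI) (metis add_le_imp_le_left le_add1 le_Suc_ex order_trans)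
next
  fix e :: real assume "e < 0"
  then show "\<forall>\<^sub>F k in sequentially. e < s k"
    using s by (intro always_eventually) (meson less_le_trans)
qed

lemma summable_increments_imp_convergent:
  fixes x :: "nat \<Rightarrow> 'a::{real_normed_vector, complete_space}"
  assumes "summable g" and g: "\<And>k. norm (x (Suc k) - x k) \<le> g k"
  shows "convergent x"
proof -
  have le: "norm (x (m + j) - x m) \<le> sum g {m..<m + j}" for m j
  proof (induction j)
    case (Suc j)
    then show ?case
      using g[of "m + j"] norm_triangle_ineq[of "x (Suc (m + j)) - x (m + j)" "x (m + j) - x m"]
      by simp
  qed simp
  have "Cauchy x"
  proof (rule CauchyI')
    fix e :: real assume "e > 0"
    then obtain N where N: "\<And>m n. m \<ge> N \<Longrightarrow> norm (sum g {m..<n}) < e"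
      using \<open>summable g\<close> unfolding summable_Cauchy by blast
    show "\<exists>M. \<forall>m\<ge>M. \<forall>n>m. dist (x m) (x n) < e"
    proof (intro exI allI impI)
      fix m n assume "N \<le> m" "m < n"
      then show "dist (x m) (x n) < e"
        using N[of m n] le[of m "n - m"] by (simp add: dist_norm norm_minus_commute)
    qed
  qed
  then show ?thesis by (rule Cauchy_convergent)
qed

section \<open>Convergence of the adaptively anchored iteration\<close>

theorem theorem3p1:
  fixes T :: "'h::{real_inner, complete_space} \<Rightarrow> 'h"
    and x :: "nat \<Rightarrow> 'h"
    and \<phi> :: "nat \<Rightarrow> real"
  assumes "nonexpansive T"
    and "Fix T \<noteq> {}"
    and "\<And>k. x k \<noteq> T (x k)"
    and "\<And>k. k \<ge> 1 \<Longrightarrow> \<phi> k =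
           2 * inner (x (k - 1) - T (x (k - 1))) (x 0 - x (k - 1))
             / (norm (x (k - 1) - T (x (k - 1))))\<^sup>2 + 1"
    and "\<And>k. k \<ge> 1 \<Longrightarrow> x k =
           (1 / (\<phi> k + 1)) *\<^sub>R x 0 + (\<phi> k / (\<phi> k + 1)) *\<^sub>R T (x (k - 1))"
  shows "\<exists>p \<in> Fix T. x \<longlonglongrightarrow> p"
proof -
  define a where "a = x 0"
  define l where "l k = 1 / (\<phi> (Suc k) + 1)" for k
  have phi: "\<phi> (Suc k) = 2 * inner (x k - T (x k)) (a - x k) / (norm (x k - T (x k)))\<^sup>2 + 1" for k
    using assms(4)[of "Suc k"] by (simp add: a_def)
  have x: "x (Suc k) = (1 / (\<phi> (Suc k) + 1)) *\<^sub>R a + (\<phi> (Suc k) / (\<phi> (Suc k) + 1)) *\<^sub>R T (x k)" for k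
    using assms(5)[of "Suc k"] by (simp add: a_def)
  have step: "\<phi> (Suc k) * (norm (x (Suc k) - T (x (Suc k))))\<^sup>2
      \<le> 2 * inner (x (Suc k) - T (x (Suc k))) (a - x (Suc k))" if "\<phi> (Suc k) > 0" for k
    using adaptive_halpern_step[OF assms(1,3) that phi x] .
  \<comment> \<open>The quotient in the next parameter is at least the current parameter by
    \<open>step\<close>, so each parameter exceeds its predecessor by at least 1, starting from
    \<open>\<phi> 1 = 1\<close>. The induction also supplies the positivity that \<open>step\<close>
    requires.\<close>
  have phi_ge: "\<phi> (Suc k) \<ge> real (Suc k)" for k
  proof (induction k)
    case 0
    then show ?case using phi[of 0] by (simp add: a_def)
  next
    case (Suc k)
    have "\<phi> (Suc k) \<le> 2 * inner (x (Suc k) - T (x (Suc k))) (a - x (Suc k))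
        / (norm (x (Suc k) - T (x (Suc k))))\<^sup>2"
      using step[of k] Suc assms(3)[of "Suc k"] by (simp add: pos_le_divide_eq)
    then show ?case
      using Suc phi[of "Suc k"] by simp
  qed
  have phi_ge1: "\<phi> (Suc k) \<ge> 1" for k
    using phi_ge[of k] by simp
  have l: "0 \<le> l k" "l k \<le> 1" for k
    using phi_ge1[of k] by (auto simp: l_def)
  have l': "\<phi> (Suc k) / (\<phi> (Suc k) + 1) = 1 - l k" for k
    using phi_ge1[of k] by (simp add: l_def field_simps)
  have xl: "x (Suc k) = l k *\<^sub>R a + (1 - l k) *\<^sub>R T (x k)" for k
    unfolding x l' by (simp add: l_def)

  have decomp: "x (Suc k) - q = l k *\<^sub>R (a - q) + (1 - l k) *\<^sub>R (T (x k) - q)" for k q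
    by (simp add: xl algebra_simps)
  have T_le: "norm (T (x k) - q) \<le> norm (x k - q)" if "q \<in> Fix T" for k q
    using nonexpansiveD[OF assms(1), of "x k" q] that by (simp add: Fix_def)
  have bound: "norm (x k - q) \<le> norm (a - q)" if "q \<in> Fix T" for k q
  proof (induction k)
    case 0
    then show ?case by (simp add: a_def)
  next
    case (Suc k)
    have "norm (x (Suc k) - q) \<le> l k * norm (a - q) + (1 - l k) * norm (T (x k) - q)"
      unfolding decomp using l[of k] by (intro norm_triangle_le) simp
    also have "\<dots> \<le> l k * norm (a - q) + (1 - l k) * norm (a - q)"
      using l[of k] T_le[OF that, of k] Suc by (intro add_left_mono mult_left_mono) auto
    finally show ?case by (simp add: algebra_simps)
  qed

  obtain q where q: "q \<in> Fix T" using assms(2) by blast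
  define D where "D = 2 * norm (a - q)"
  have aD: "norm (a - x k) \<le> D" for k
    using bound[OF q, of k] norm_triangle_ineq4[of "a - q" "x k - q"] by (simp add: D_def)
  \<comment> \<open>Cancelling one residual norm \<open>?r\<close> leaves
    \<open>\<phi> (Suc k) * ?r \<le> 2 * D\<close>; as the parameter is at least 1,
    \<open>?r\<close> itself obeys the same bound, and adding the two gives 4.\<close>
  have res: "norm (x (Suc k) - T (x (Suc k))) \<le> 4 * D * l k" for k
  proof -
    let ?r = "norm (x (Suc k) - T (x (Suc k)))"
    have "\<phi> (Suc k) * ?r * ?r \<le> 2 * inner (x (Suc k) - T (x (Suc k))) (a - x (Suc k))"
      using step[of k] phi_ge1[of k] by (simp add: power2_eq_square)
    also have "\<dots> \<le> 2 * (?r * norm (a - x (Suc k)))"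
      by (intro mult_left_mono norm_cauchy_schwarz) auto
    also have "\<dots> \<le> 2 * (?r * D)"
      by (intro mult_left_mono aD) auto
    finally have "?r * (\<phi> (Suc k) * ?r) \<le> ?r * (2 * D)"
      by (simp add: algebra_simps)
    moreover have "?r > 0" using assms(3)[of "Suc k"] by simp
    ultimately have *: "\<phi> (Suc k) * ?r \<le> 2 * D" by simp
    have "1 * ?r \<le> \<phi> (Suc k) * ?r"
      using phi_ge1[of k] by (intro mult_right_mono) auto
    with * have "(\<phi> (Suc k) + 1) * ?r \<le> 4 * D" by (simp add: algebra_simps)
    then show ?thesis
      using phi_ge1[of k] by (simp add: l_def field_simps)
  qed
  have "l \<longlonglongrightarrow> 0"
  proof (rule tendsto_sandwich[OF _ _ tendsto_const LIMSEQ_inverse_real_of_nat])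
    show "\<forall>\<^sub>F k in sequentially. 0 \<le> l k" using l by simp
    show "\<forall>\<^sub>F k in sequentially. l k \<le> inverse (real (Suc k))"
    proof (intro always_eventually allI)
      show "l k \<le> inverse (real (Suc k))" for k
        unfolding l_def inverse_eq_divide using phi_ge[of k] by (intro divide_left_mono) auto
    qed
  qed
  then have "(\<lambda>k. 4 * D * l k) \<longlonglongrightarrow> 0"
    by (rule tendsto_mult_right_zero)
  then have "(\<lambda>k. x (Suc k) - T (x (Suc k))) \<longlonglongrightarrow> 0"
    by (rule Lim_null_comparison[rotated]) (intro always_eventually allI res)
  then have res0: "(\<lambda>k. x k - T (x k)) \<longlonglongrightarrow> 0"
    by (rule LIMSEQ_imp_Suc)

  show ?thesis
  proof (cases "summable l")
    case True
    \<comment> \<open>Taking \<open>q = x (Suc k)\<close> in \<open>decomp\<close> splits the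
      increment into the pull towards \<open>a\<close> and a residual. Indices start at
      \<open>Suc k\<close> because \<open>res\<close> says nothing about \<open>x 0\<close>.\<close>
    have "norm (x (Suc (Suc k)) - x (Suc k)) \<le> D * l (Suc k) + 4 * D * l k" for k
    proof -
      have "norm (x (Suc (Suc k)) - x (Suc k))
          \<le> l (Suc k) * norm (a - x (Suc k)) + (1 - l (Suc k)) * norm (T (x (Suc k)) - x (Suc k))"
        unfolding decomp using l[of "Suc k"] by (intro norm_triangle_le) simp
      also have "\<dots> \<le> l (Suc k) * D + 1 * norm (T (x (Suc k)) - x (Suc k))"
        using l[of "Suc k"] by (intro add_mono mult_left_mono mult_right_mono aD) auto
      finally show ?thesis
        using res[of k] by (simp add: norm_minus_commute mult.commute)
    qed
    moreover have "summable (\<lambda>k. D * l (Suc k) + 4 * D * l k)"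
      using True by (intro summable_add summable_mult) (simp_all add: summable_Suc_iff)
    ultimately have "convergent (\<lambda>k. x (Suc k))"
      by (intro summable_increments_imp_convergent)
    then obtain p where p: "x \<longlonglongrightarrow> p"
      using LIMSEQ_imp_Suc by (auto simp: convergent_def)
    have "(\<lambda>k. x k - T (x k)) \<longlonglongrightarrow> p - T p"
      by (intro tendsto_diff p isCont_tendsto_compose[OF nonexpansive_isCont[OF assms(1)]])
    then have "p - T p = 0"
      using res0 LIMSEQ_unique by blast
    with p show ?thesis by (auto simp: Fix_def)
  next
    case False
    have "\<forall>n. \<exists>z. a - z = real (Suc n) *\<^sub>R (z - T z)"
      by (intro allI resolvent_exists[OF assms(1)]) simp
    then obtain z where z: "\<And>n. a - z n = real (Suc n) *\<^sub>R (z n - T (z n))"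
      by metis
    obtain p where p: "p \<in> Fix T" "z \<longlonglongrightarrow> p"
      using resolvent_path_convergent[OF assms(1) q z] by blast
    have "(\<lambda>k. (norm (x k - p))\<^sup>2) \<longlonglongrightarrow> 0"
    proof (rule Xu_recursion_tendsto_0[where l = l and b = "\<lambda>k. 2 * inner (a - p) (x (Suc k) - p)"])
      fix k
      define u v where "u = l k *\<^sub>R (a - p)" and "v = (1 - l k) *\<^sub>R (T (x k) - p)"
      have uv: "x (Suc k) - p = u + v"
        by (simp add: decomp u_def v_def)
      \<comment> \<open>Pairing \<open>u\<close> with the full sum \<open>u + v\<close> drops only
        the term - |u|^2; this is why \<open>b\<close> contains \<open>x (Suc k)\<close> rather than
        \<open>x k\<close>.\<close>
      have "inner (u + v) (u + v) \<le> inner v v + 2 * inner u (u + v)"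
        using inner_ge_zero[of u] by (simp add: inner_add inner_commute)
      then have "(norm (x (Suc k) - p))\<^sup>2
          \<le> (norm v)\<^sup>2 + 2 * inner u (x (Suc k) - p)"
        by (simp only: uv power2_norm_eq_inner)
      moreover have "norm v = (1 - l k) * norm (T (x k) - p)"
        using l[of k] by (simp add: v_def)
      moreover have "2 * inner u (x (Suc k) - p) = l k * (2 * inner (a - p) (x (Suc k) - p))"
        by (simp add: u_def)
      moreover have "((1 - l k) * norm (T (x k) - p))\<^sup>2 \<le> (1 - l k) * (norm (x k - p))\<^sup>2"
        unfolding power_mult_distrib
      proof (intro mult_mono power_mono T_le p)
        show "(1 - l k)\<^sup>2 \<le> 1 - l k"
          using l[of k] by (simp add: power2_eq_square mult_left_le)
      qed (use l[of k] in auto)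
      ultimately show "(norm (x (Suc k) - p))\<^sup>2
          \<le> (1 - l k) * (norm (x k - p))\<^sup>2 + l k * (2 * inner (a - p) (x (Suc k) - p))"
        by simp
    next
      fix e :: real assume "e > 0"
      then have "\<forall>\<^sub>F k in sequentially. inner (a - p) (x k - p) \<le> e / 2"
        by (intro limsup_inner_resolvent_limit[OF assms(1) z p(2) res0 bound[OF p(1)]]) simp
      then have "\<forall>\<^sub>F k in sequentially. inner (a - p) (x (Suc k) - p) \<le> e / 2"
        by (rule eventually_sequentially_Suc[THEN iffD2])
      then show "\<forall>\<^sub>F k in sequentially. 2 * inner (a - p) (x (Suc k) - p) \<le> e"
        by eventually_elim simp
    qed (use l False in auto)
    from tendsto_real_sqrt[OF this] have "x \<longlonglongrightarrow> p"
      by (simp add: tendsto_norm_zero_iff LIM_zero_iff)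
    with p(1) show ?thesis by blast
  qed
qed

end
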